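(* Let $G$ be a graph, and suppose there exist $F_1,F_2,F_3,F_4\in\mathrm{MaxInd}(G)$ such that $F_3\cup F_4\subsetneq F_1\cup F_2$ and $F_3\cap F_4=\emptyset$. Then $G$ is not levelable.
   Context: All graphs are finite and simple. $\mathrm{MaxInd}(G)$ denotes the set of maximal (under inclusion) independent sets of vertices of $G$. A graph $G$ on $\{x_1,\ldots,x_n\}$ is levelable if there exist positive integers $c_1,\ldots,c_n$ and a constant $c$ such that $\sum_{x_i\in W}c_i=c$ for every $W\in\mathrm{MaxInd}(G)$. *)

theory Defs
  imports "Graph_Theory.Digraph"
begin

text \<open>A finite simple graph is a pre_digraph satisfying the locale predicate graph of
  Graph_Theory: finite, loop-free, without parallel arcs, and symmetric, each undirected edge
  being represented by a pair of opposite arcs.\<close>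

definition independent_set :: "('a, 'b) pre_digraph \<Rightarrow> 'a set \<Rightarrow> bool" where
  "independent_set G W \<longleftrightarrow>
     W \<subseteq> verts G \<and> (\<forall>u\<in>W. \<forall>v\<in>W. \<not> u \<rightarrow>\<^bsub>G\<^esub> v)"

definition MaxInd :: "('a, 'b) pre_digraph \<Rightarrow> 'a set set" where
  "MaxInd G = {W. independent_set G W \<and> (\<forall>W'. independent_set G W' \<and> W \<subseteq> W' \<longrightarrow> W' = W)}"

definition levelable :: "('a, 'b) pre_digraph \<Rightarrow> bool" where
  "levelable G \<longleftrightarrow>
     (\<exists>(w :: 'a \<Rightarrow> int) (c :: int).
        (\<forall>x\<in>verts G. 0 < w x) \<and> (\<forall>W\<in>MaxInd G. (\<Sum>x\<in>W. w x) = c))"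

end

theory Submission
  imports Defs
begin

text \<open>Compare total weights under a supposed levelling \<open>w\<close> with constant
  \<open>c\<close>. Disjointness makes \<open>F3 \<union> F4\<close> weigh exactly
  \<open>2 * c\<close>. Since all weights are positive, the strictly larger set
  \<open>F1 \<union> F2\<close> weighs more than \<open>2 * c\<close>; yet a union never outweighs
  the sum of its two parts, here again \<open>2 * c\<close>.\<close>

theorem lemma2p7:
  fixes G :: "('a, 'b) pre_digraph" and F1 F2 F3 F4 :: "'a set"
  assumes "graph G"
    and "F1 \<in> MaxInd G" and "F2 \<in> MaxInd G" and "F3 \<in> MaxInd G" and "F4 \<in> MaxInd G"
    and "F3 \<union> F4 \<subset> F1 \<union> F2"
    and "F3 \<inter> F4 = {}"
  shows "\<not> levelable G"
proof
  assume "levelable G"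
  then obtain w :: "'a \<Rightarrow> int" and c :: int
    where pos: "\<And>x. x \<in> verts G \<Longrightarrow> 0 < w x"
      and level: "\<And>W. W \<in> MaxInd G \<Longrightarrow> sum w W = c"
    unfolding levelable_def by blast
  interpret graph G by fact
  have sub: "W \<subseteq> verts G" if "W \<in> MaxInd G" for W
    using that by (simp add: MaxInd_def independent_set_def)
  have fin: "finite W" if "W \<in> MaxInd G" for W
    using sub[OF that] finite_verts by (rule finite_subset)
  obtain b where b: "b \<in> F1 \<union> F2" "b \<notin> F3 \<union> F4"
    using assms(6) by blast
  have verts: "F1 \<union> F2 \<subseteq> verts G"
    using sub assms(2,3) by simp
  have "2 * c = sum w (F3 \<union> F4)"
    using assms(4,5,7) by (simp add: sum.union_disjoint fin level)
  also have "\<dots> < sum w (F1 \<union> F2)"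
  \<comment> \<open>The strict inequality comes from \<open>b\<close> alone, a vertex of positive
    weight outside the smaller union.\<close>
  proof (rule sum_strict_mono2)
    show "0 < w b" "\<And>x. x \<in> F1 \<union> F2 \<Longrightarrow> 0 \<le> w x"
      using b verts pos by (auto intro: less_imp_le)
  qed (use assms(2,3,6) b fin in auto)
  \<comment> \<open>Inclusion-exclusion: the two sides differ by the weight of
    \<open>F1 \<inter> F2\<close>, which is nonnegative.\<close>
  also have "\<dots> \<le> sum w F1 + sum w F2"
    using sum.union_inter[of F1 F2 w] sum_nonneg[of "F1 \<inter> F2" w] assms(2,3) verts pos
    by (fastforce simp: fin intro: less_imp_le)
  also have "\<dots> = 2 * c"
    using assms(2,3) by (simp add: level)
  finally show False by simp
qed

end
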